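(* Let $q$ be a prime power, let $Q \in \mathbb{F}_q[T]$ be a monic prime (irreducible) polynomial, and let $n,k$ be integers with $0 \leq n \leq \deg Q - 1 \leq k$. Then $$\frac{1}{q^{k+n}} \sum_{K \in \mathcal{M}_k } \sum_{N \in \mathcal{M}_n } d (KQ+N)\, d (N) = \bigg( \frac{1}{q^n } \sum_{N \in \mathcal{M}_n} d(N) \bigg) \bigg( \frac{1}{q^{k + n}} \sum_{K \in \mathcal{M}_k } \sum_{N \in \mathcal{M}_n } d (KQ+N) \bigg),$$ and this common value equals $$(\deg Q + k +1) (n+1) - q^{-\deg Q} (k - \deg Q +1) (n+1) .$$
   Context: $\mathcal{M}$ is the set of monic polynomials in $\mathbb{F}_q[T]$ and $\mathcal{M}_j$ is the set of those of degree $j$. For $N \in \mathcal{M}$, $d(N)$ is the number of pairs $(A_1,A_2) \in \mathcal{M}^2$ with $A_1A_2 = N$. *)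

theory Defs
  imports Complex_Main "HOL-Library.Cardinality" "HOL-Computational_Algebra.Computational_Algebra"
begin

definition monics :: "'a::field poly set" where
  "monics = {N. lead_coeff N = 1}"

definition monics_deg :: "nat \<Rightarrow> 'a::field poly set" where
  "monics_deg j = {N \<in> monics. degree N = j}"

(* Only used for monic N over a finite field, where the set of pairs is finite. *)
definition divisor_count :: "'a::field poly \<Rightarrow> nat" where
  "divisor_count N = card {(A\<^sub>1, A\<^sub>2). A\<^sub>1 \<in> monics \<and> A\<^sub>2 \<in> monics \<and> A\<^sub>1 * A\<^sub>2 = N}"

end

theory Submission
  imports Defs
begin

text \<open>
  Write \<open>D = degree Q\<close>. The whole theorem rests on one fact: for a fixed monic \<open>N\<close> of degree
  below \<open>D\<close>, the inner sum \<open>\<Sum>K. d(KQ + N)\<close> does not depend on \<open>N\<close>, so it factors out of the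
  correlation.

  The polynomials \<open>KQ + N\<close> are exactly the monic polynomials of degree \<open>k + D\<close> that are congruent
  to \<open>N\<close> modulo \<open>Q\<close>, so the inner sum counts the pairs \<open>(A, B)\<close> of monic polynomials with
  \<open>degree A + degree B = k + D\<close> and \<open>AB \<equiv> N\<close> (lemma \<open>sum_divisor_count\<close>). Since
  \<open>k \<ge> D - 1\<close>, the two degrees cannot both be below \<open>D\<close>; by symmetry let \<open>degree B \<ge> D\<close>. As \<open>Q\<close> is
  irreducible and does not divide \<open>N\<close>, the factor \<open>A\<close> must be prime to \<open>Q\<close>, and then \<open>B\<close> ranges
  over a single residue class modulo \<open>Q\<close>. Such a class is equidistributed exactly: it has
  \<open>q ^ (degree B - D)\<close> monic members of that degree (lemma \<open>card_monics_deg_residue_class\<close>).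
  Hence a degree split contributes \<open>q ^ k\<close>, or \<open>q ^ k - q ^ (k - D)\<close> when \<open>degree A \<ge> D\<close> too and the
  multiples of \<open>Q\<close> have to be removed. The latter happens for \<open>k - D + 1\<close> of the \<open>k + D + 1\<close>
  splits, and \<open>\<Sum>N. d(N) = (n + 1) q ^ n\<close> supplies the other factor.
\<close>

section \<open>Monic polynomials of given degree\<close>

lemma monics_deg_iff: "p \<in> monics_deg j \<longleftrightarrow> lead_coeff p = 1 \<and> degree p = j"
  by (auto simp: monics_deg_def monics_def)

lemma monics_deg_0: "monics_deg 0 = {1 :: 'a::field poly}"
proof (intro equalityI subsetI)
  fix p :: "'a poly" assume "p \<in> monics_deg 0"
  then have "lead_coeff p = 1" "degree p = 0" unfolding monics_deg_iff by blast+
  then show "p \<in> {1}" by (auto elim!: degree_eq_zeroE)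
qed (simp add: monics_deg_iff)

lemma monics_deg_Suc:
  "monics_deg (Suc j) = (\<lambda>(c, p). pCons c p) ` (UNIV \<times> (monics_deg j :: 'a::field poly set))"
proof (intro equalityI subsetI)
  fix p :: "'a poly" assume p: "p \<in> monics_deg (Suc j)"
  obtain c r where r: "p = pCons c r" by (cases p)
  with p have "r \<in> monics_deg j"
    by (auto simp: monics_deg_iff split: if_splits)
  with r show "p \<in> (\<lambda>(c, p). pCons c p) ` (UNIV \<times> monics_deg j)" by auto
next
  fix p :: "'a poly" assume "p \<in> (\<lambda>(c, p). pCons c p) ` (UNIV \<times> monics_deg j)"
  then show "p \<in> monics_deg (Suc j)"
    by (auto simp: monics_deg_iff)
qed

lemma finite_monics_deg [simp]: "finite (monics_deg j :: 'a::{field,finite} poly set)"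
  by (induction j) (simp_all add: monics_deg_0 monics_deg_Suc)

lemma card_monics_deg: "card (monics_deg j :: 'a::{field,finite} poly set) = CARD('a) ^ j"
proof (induction j)
  case (Suc j)
  have "inj_on (\<lambda>(c, p). pCons c p) (UNIV \<times> (monics_deg j :: 'a poly set))"
    by (auto simp: inj_on_def)
  then show ?case
    by (simp add: monics_deg_Suc card_image card_cartesian_product Suc.IH)
qed (simp add: monics_deg_0)

lemma monics_deg_mult:
  "A \<in> monics_deg a \<Longrightarrow> B \<in> monics_deg b \<Longrightarrow> A * B \<in> monics_deg (a + b)"
  by (auto simp: monics_deg_iff lead_coeff_mult intro!: degree_mult_eq)

lemma finite_degree_less: "finite {p :: 'a::{field,finite} poly. degree p < D}"
proof (rule finite_imageD)
  \<comment> \<open>Adding the monomial of degree \<open>D\<close> turns a polynomial of smaller degree into a monic one.\<close>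
  have "p + monom 1 D \<in> monics_deg D" if "degree p < D" for p :: "'a poly"
    using that
    by (simp add: monics_deg_iff degree_add_eq_right degree_monom_eq coeff_eq_0)
  then have "(\<lambda>p. p + monom 1 D) ` {p :: 'a poly. degree p < D} \<subseteq> monics_deg D"
    by auto
  then show "finite ((\<lambda>p. p + monom 1 D) ` {p :: 'a poly. degree p < D})"
    by (rule finite_subset) simp
qed (simp add: inj_on_def)

section \<open>Residue classes modulo a monic polynomial\<close>

text \<open>
  Division with remainder by \<open>Q\<close> matches the monic polynomials of degree \<open>k + degree Q\<close> in the class
  of \<open>R\<close> with their quotients; monicity of \<open>Q\<close> makes the quotient monic as well.
\<close>

lemma bij_betw_monics_deg_residue_class:
  fixes Q R :: "'a::field poly"
  assumes Q: "lead_coeff Q = 1" and R: "degree R < degree Q"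
  shows "bij_betw (\<lambda>K. K * Q + R) (monics_deg k) {M \<in> monics_deg (k + degree Q). M mod Q = R}"
proof (rule bij_betw_byWitness[where f' = "\<lambda>M. M div Q"])
  have "Q \<noteq> 0" using Q by auto
  have modR: "R mod Q = R" "R div Q = 0" using R by (simp_all add: mod_poly_less div_poly_less)
  show "\<forall>K\<in>monics_deg k. (K * Q + R) div Q = K"
    using \<open>Q \<noteq> 0\<close> modR by (simp add: div_add1_eq)
  show "\<forall>M\<in>{M \<in> monics_deg (k + degree Q). M mod Q = R}. M div Q * Q + R = M"
    by auto
  show "(\<lambda>K. K * Q + R) ` monics_deg k \<subseteq> {M \<in> monics_deg (k + degree Q). M mod Q = R}"
  proof (intro image_subsetI CollectI conjI)
    fix K :: "'a poly" assume K: "K \<in> monics_deg k"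
    then have "K * Q \<in> monics_deg (k + degree Q)"
      using Q by (intro monics_deg_mult) (auto simp: monics_deg_iff)
    then show "K * Q + R \<in> monics_deg (k + degree Q)"
      using R by (auto simp: monics_deg_iff degree_add_eq_left coeff_eq_0)
    show "(K * Q + R) mod Q = R"
      using modR by simp
  qed
  show "(\<lambda>M. M div Q) ` {M \<in> monics_deg (k + degree Q). M mod Q = R} \<subseteq> monics_deg k"
  proof (intro image_subsetI)
    fix M assume "M \<in> {M \<in> monics_deg (k + degree Q). M mod Q = R}"
    then have M: "lead_coeff M = 1" "degree M = k + degree Q" and "M mod Q = R"
      by (auto simp: monics_deg_iff)
    then have eq: "M - R = (M div Q) * Q"
      by (metis add_diff_cancel_right' div_mult_mod_eq)
    have "degree (M - R) = k + degree Q"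
      using degree_add_eq_left[of "- R" M] M R by simp
    then have deg: "degree (M - R) = k + degree Q" "lead_coeff (M - R) = 1"
      using M R by (simp_all add: coeff_eq_0)
    then have "M div Q \<noteq> 0" using eq by auto
    then have "degree (M div Q) = k"
      using deg eq \<open>Q \<noteq> 0\<close> by (simp add: degree_mult_eq)
    moreover have "lead_coeff (M div Q) = 1"
      using deg eq Q by (metis lead_coeff_mult mult.right_neutral)
    ultimately show "M div Q \<in> monics_deg k" by (simp add: monics_deg_iff)
  qed
qed

lemma card_monics_deg_residue_class:
  fixes Q R :: "'a::{field,finite} poly"
  assumes "lead_coeff Q = 1" and "degree R < degree Q" and "degree Q \<le> b"
  shows "card {B \<in> monics_deg b. B mod Q = R} = CARD('a) ^ (b - degree Q)"
  using bij_betw_same_card[OF bij_betw_monics_deg_residue_class[OF assms(1,2), of "b - degree Q"]]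
    assms(3) by (simp add: card_monics_deg)

lemma card_monics_deg_multiples:
  fixes Q :: "'a::{field,finite} poly"
  assumes "lead_coeff Q = 1" and "0 < degree Q"
  shows "card {A \<in> monics_deg a. Q dvd A} =
    (if degree Q \<le> a then CARD('a) ^ (a - degree Q) else 0)"
proof (cases "degree Q \<le> a")
  case True
  then show ?thesis
    using card_monics_deg_residue_class[of Q 0 a] assms by (simp add: dvd_eq_mod_eq_0)
next
  case False
  have "\<not> Q dvd A" if "A \<in> monics_deg a" for A
    using that False dvd_imp_degree_le[of Q A] leading_coeff_0_iff[of A]
    by (auto simp: monics_deg_iff simp del: leading_coeff_0_iff)
  then have "{A \<in> monics_deg a. Q dvd A} = {}" by blast
  then show ?thesis using False by simp
qed

text \<open>
  Multiplication by \<open>A\<close> is injective on the finite set of reduced residues, because \<open>Q\<close> is prime and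
  does not divide \<open>A\<close>; hence it is surjective, and the congruence \<open>AX \<equiv> N\<close> has a unique solution.
\<close>

lemma residue_quotient:
  fixes Q A N :: "'a::{field,finite} poly"
  assumes Q: "irreducible Q" and A: "\<not> Q dvd A" and N: "degree N < degree Q"
  obtains R where "degree R < degree Q" and "\<And>B. A * B mod Q = N \<longleftrightarrow> B mod Q = R"
proof -
  let ?S = "{p :: 'a poly. degree p < degree Q}" and ?f = "\<lambda>B. A * B mod Q"
  have prime: "prime_elem Q" using Q by (rule field_poly_irreducible_imp_prime)
  have "Q \<noteq> 0" using Q by auto
  have cancel: "B mod Q = C mod Q" if "A * B mod Q = A * C mod Q" for B C
  proof -
    have "Q dvd A * (B - C)"
      using that by (simp add: mod_eq_dvd_iff right_diff_distrib)
    then have "Q dvd B - C" using A prime by (simp add: prime_elem_dvd_mult_iff)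
    then show ?thesis by (simp add: mod_eq_dvd_iff)
  qed
  have "inj_on ?f ?S"
  proof (rule inj_onI)
    fix B C assume "B \<in> ?S" "C \<in> ?S" "A * B mod Q = A * C mod Q"
    then show "B = C" using cancel[of B C] by (simp add: mod_poly_less)
  qed
  moreover have "?f ` ?S \<subseteq> ?S"
  proof -
    have "degree (p mod Q) < degree Q" for p
      using N \<open>Q \<noteq> 0\<close> degree_mod_less[of Q p] by auto
    then show ?thesis by auto
  qed
  ultimately have "?f ` ?S = ?S"
    by (intro endo_inj_surj finite_degree_less)
  then obtain R where R: "degree R < degree Q" "A * R mod Q = N"
    using N by (metis (no_types, lifting) imageE mem_Collect_eq)
  have "A * B mod Q = N \<longleftrightarrow> B mod Q = R" for B
  proof
    assume "A * B mod Q = N"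
    then show "B mod Q = R" using cancel[of B R] R by (simp add: mod_poly_less)
  next
    assume "B mod Q = R"
    then show "A * B mod Q = N" using R by (metis mod_mult_right_eq)
  qed
  with R that show thesis by blast
qed

section \<open>Sums of the divisor function\<close>

text \<open>
  Both sums of divisor counts are evaluated by exchanging summation: instead of factoring each
  member of \<open>S\<close>, one counts the pairs whose product lands in \<open>S\<close>, sorted by the degree of the first
  factor.
\<close>

lemma sum_divisor_count:
  fixes S :: "'a::{field,finite} poly set"
  assumes S: "S \<subseteq> monics_deg m"
  shows "(\<Sum>M\<in>S. divisor_count M) =
    (\<Sum>a\<le>m. card {(A, B) \<in> monics_deg a \<times> monics_deg (m - a). A * B \<in> S})"
proof -
  let ?P = "\<lambda>M. {(A, B). A \<in> monics \<and> B \<in> monics \<and> A * B = M}"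
  let ?R = "\<lambda>a. {(A, B) \<in> monics_deg a \<times> monics_deg (m - a). A * B \<in> S}"
  have finR: "finite (?R a)" for a
    by (rule finite_subset[of _ "monics_deg a \<times> monics_deg (m - a)"]) auto
  have eq: "(\<Union>M\<in>S. ?P M) = (\<Union>a\<le>m. ?R a)"
  proof (intro equalityI subsetI)
    fix x assume "x \<in> (\<Union>M\<in>S. ?P M)"
    then obtain A B where x: "x = (A, B)" "A \<in> monics" "B \<in> monics" "A * B \<in> S" by auto
    then have "A \<in> monics_deg (degree A)" "B \<in> monics_deg (degree B)"
      by (auto simp: monics_deg_def)
    moreover from this have "degree A + degree B = m"
      using monics_deg_mult[of A "degree A" B "degree B"] x(4) S
      by (auto simp: monics_deg_iff)
    ultimately have "degree A \<le> m" "x \<in> ?R (degree A)" using x by auto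
    then show "x \<in> (\<Union>a\<le>m. ?R a)" by blast
  qed (auto simp: monics_deg_def)
  have finP: "finite (?P M)" if "M \<in> S" for M
    by (rule finite_subset[of _ "\<Union>a\<le>m. ?R a"]) (use that eq finR in auto)
  have "(\<Sum>M\<in>S. divisor_count M) = card (\<Union>M\<in>S. ?P M)"
    unfolding divisor_count_def
    by (rule card_UN_disjoint[symmetric])
      (use finP S finite_subset in \<open>auto intro: finite_subset[OF S]\<close>)
  also have "\<dots> = (\<Sum>a\<le>m. card (?R a))"
    unfolding eq
    by (rule card_UN_disjoint) (use finR in \<open>auto simp: monics_deg_iff\<close>)
  finally show ?thesis .
qed

lemma sum_divisor_count_monics_deg:
  "(\<Sum>N\<in>(monics_deg n :: 'a::{field,finite} poly set). divisor_count N) = (n + 1) * CARD('a) ^ n"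
proof -
  have "card {(A, B) \<in> monics_deg a \<times> monics_deg (n - a). A * B \<in> (monics_deg n :: 'a poly set)}
      = CARD('a) ^ n" if "a \<le> n" for a
  proof -
    have "{(A, B) \<in> monics_deg a \<times> monics_deg (n - a). A * B \<in> (monics_deg n :: 'a poly set)}
        = monics_deg a \<times> monics_deg (n - a)"
      using monics_deg_mult[of _ a _ "n - a"] that by auto
    then show ?thesis
      using that by (simp add: card_cartesian_product card_monics_deg flip: power_add)
  qed
  then have "(\<Sum>a\<le>n. card {(A, B) \<in> monics_deg a \<times> monics_deg (n - a). A * B \<in> (monics_deg n :: 'a poly set)})
      = (\<Sum>a\<le>n. CARD('a) ^ n)"
    by (intro sum.cong) auto
  then show ?thesis by (simp add: sum_divisor_count[OF subset_refl])
qed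

section \<open>Factorisations within a residue class\<close>

text \<open>
  When the second factor has degree at least that of \<open>Q\<close>, every admissible first factor has the same
  number of partners. A multiple of \<open>Q\<close> is not admissible, since \<open>N \<noteq> 0\<close> is a reduced residue.
\<close>

lemma card_factor_pairs_residue_class:
  fixes Q N :: "'a::{field,finite} poly"
  assumes Q: "lead_coeff Q = 1" "irreducible Q" and N: "N \<noteq> 0" "degree N < degree Q"
    and b: "degree Q \<le> b"
  shows "card {(A, B) \<in> monics_deg a \<times> monics_deg b. A * B mod Q = N} =
    card {A \<in> monics_deg a. \<not> Q dvd A} * CARD('a) ^ (b - degree Q)"
proof -
  let ?B = "\<lambda>A. {B \<in> monics_deg b. A * B mod Q = N}"
  have ndvd: "\<not> Q dvd A" if "A * B mod Q = N" for A B
    using that N by (auto simp: dvd_eq_mod_eq_0[symmetric])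
  have "{(A, B) \<in> monics_deg a \<times> monics_deg b. A * B mod Q = N} =
      (SIGMA A : {A \<in> monics_deg a. \<not> Q dvd A}. ?B A)"
    using N(1) by (auto dest: ndvd)
  moreover have "card (?B A) = CARD('a) ^ (b - degree Q)" if ndvdA: "\<not> Q dvd A" for A
  proof -
    obtain R where "degree R < degree Q" "\<And>B. A * B mod Q = N \<longleftrightarrow> B mod Q = R"
      using residue_quotient[OF Q(2) ndvdA N(2)] by blast
    then show ?thesis using card_monics_deg_residue_class[OF Q(1) _ b] by simp
  qed
  ultimately show ?thesis by simp
qed

lemma card_factor_pairs_commute:
  "card {(A, B) \<in> monics_deg a \<times> monics_deg b. A * B mod Q = N} =
    card {(A, B) \<in> monics_deg b \<times> monics_deg a. A * B mod Q = (N :: 'a::field poly)}"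
  by (rule bij_betw_same_card[where f = prod.swap],
      rule bij_betw_byWitness[where f' = prod.swap]) (auto simp: mult.commute)

text \<open>
  The value is symmetric in \<open>a\<close> and \<open>b\<close>, so the longer factor may be taken to be the second one.
\<close>

lemma card_factor_pairs_by_degrees:
  fixes Q N :: "'a::{field,finite} poly"
  assumes Q: "lead_coeff Q = 1" "irreducible Q" and N: "N \<noteq> 0" "degree N < degree Q"
    and ab: "a + b = k + degree Q" and long: "degree Q \<le> a \<or> degree Q \<le> b"
  shows "real (card {(A, B) \<in> monics_deg a \<times> monics_deg b. A * B mod Q = N}) =
    real CARD('a) ^ k -
      (if degree Q \<le> a \<and> degree Q \<le> b then real CARD('a) ^ k / real CARD('a) ^ degree Q else 0)"
proof -
  let ?q = "real CARD('a)" and ?D = "degree Q"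
  have main: "real (card {(A, B) \<in> monics_deg a \<times> monics_deg b. A * B mod Q = N}) =
    ?q ^ k - (if ?D \<le> a \<and> ?D \<le> b then ?q ^ k / ?q ^ ?D else 0)"
    if ab: "a + b = k + ?D" and b: "?D \<le> b" for a b
  proof -
    have "card {A \<in> monics_deg a. \<not> Q dvd A} =
        card (monics_deg a - {A \<in> monics_deg a. Q dvd A})"
      by (rule arg_cong[where f = card]) auto
    also have "\<dots> = card (monics_deg a :: 'a poly set) - card {A \<in> monics_deg a. Q dvd A}"
      by (rule card_Diff_subset) auto
    finally have "real (card {A \<in> monics_deg a. \<not> Q dvd A}) =
        ?q ^ a - (if ?D \<le> a then ?q ^ (a - ?D) else 0)"
      using N by (simp add: card_monics_deg card_monics_deg_multiples[OF Q(1)]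
          of_nat_diff power_increasing)
    moreover have "?q ^ a * ?q ^ (b - ?D) = ?q ^ k"
      using ab b by (simp flip: power_add)
    moreover have "?q ^ (a - ?D) * ?q ^ (b - ?D) = ?q ^ k / ?q ^ ?D" if "?D \<le> a"
    proof -
      have "?q ^ (a - ?D) * ?q ^ (b - ?D) = ?q ^ (k - ?D)" and "?D \<le> k"
        using ab b that by (simp_all flip: power_add)
      then show ?thesis by (simp add: power_diff)
    qed
    ultimately show ?thesis
      unfolding card_factor_pairs_residue_class[OF Q N b] of_nat_mult of_nat_power
      using b by (simp add: left_diff_distrib)
  qed
  show ?thesis
  proof (cases "?D \<le> b")
    case True
    then show ?thesis using main[OF ab] by simp
  next
    case False
    then show ?thesis
      using main[of b a] ab long by (subst card_factor_pairs_commute) (simp add: add.commute)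
  qed
qed

text \<open>
  The right-hand side does not mention \<open>N\<close>: this is the decorrelation.
\<close>

lemma sum_divisor_count_residue_class:
  fixes Q N :: "'a::{field,finite} poly"
  assumes Q: "lead_coeff Q = 1" "irreducible Q" and N: "N \<noteq> 0" "degree N < degree Q"
    and k: "degree Q \<le> k + 1"
  shows "(\<Sum>K\<in>monics_deg k. real (divisor_count (K * Q + N))) =
    (real (degree Q) + real k + 1) * real CARD('a) ^ k -
    (real k - real (degree Q) + 1) * (real CARD('a) ^ k / real CARD('a) ^ degree Q)"
proof -
  let ?q = "real CARD('a)" and ?D = "degree Q"
  let ?m = "k + ?D"
  let ?S = "{M \<in> monics_deg ?m. M mod Q = N}"
  have "(\<Sum>K\<in>monics_deg k. real (divisor_count (K * Q + N))) = (\<Sum>M\<in>?S. real (divisor_count M))"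
    using sum.reindex_bij_betw[OF bij_betw_monics_deg_residue_class[OF Q(1) N(2)],
        of "\<lambda>M. real (divisor_count M)" k] .
  also have "\<dots> = real (\<Sum>M\<in>?S. divisor_count M)" by simp
  also have "\<dots> =
      (\<Sum>a\<le>?m. real (card {(A, B) \<in> monics_deg a \<times> monics_deg (?m - a). A * B \<in> ?S}))"
    by (subst sum_divisor_count[of _ ?m]) auto
  also have "\<dots> = (\<Sum>a\<le>?m. ?q ^ k - (if a \<in> {?D..k} then ?q ^ k / ?q ^ ?D else 0))"
  proof (rule sum.cong[OF refl])
    fix a assume "a \<in> {..?m}"
    then have a: "a + (?m - a) = ?m" by simp
    have "{(A, B) \<in> monics_deg a \<times> monics_deg (?m - a). A * B \<in> ?S} =
        {(A, B) \<in> monics_deg a \<times> monics_deg (?m - a). A * B mod Q = N}"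
      using monics_deg_mult[of _ a _ "?m - a"] a by auto
    \<comment> \<open>Two degrees below \<open>?D\<close> add up to at most \<open>2 * ?D - 2\<close>, which is less than \<open>?m\<close>.\<close>
    moreover have "?D \<le> a \<or> ?D \<le> ?m - a" using a k by linarith
    moreover have "?D \<le> a \<and> ?D \<le> ?m - a \<longleftrightarrow> a \<in> {?D..k}" using a by auto
    ultimately show "real (card {(A, B) \<in> monics_deg a \<times> monics_deg (?m - a). A * B \<in> ?S}) =
        ?q ^ k - (if a \<in> {?D..k} then ?q ^ k / ?q ^ ?D else 0)"
      using card_factor_pairs_by_degrees[OF Q N a] by simp
  qed
  also have "\<dots> = real (?m + 1) * ?q ^ k - real (k + 1 - ?D) * (?q ^ k / ?q ^ ?D)"
  proof -
    have "{..?m} \<inter> {?D..k} = {?D..k}" by auto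
    then show ?thesis by (simp add: sum_subtractf sum.If_cases del: atLeastAtMost_iff)
  qed
  finally show ?thesis using k by (simp add: of_nat_diff algebra_simps)
qed

section \<open>The correlation of divisor functions\<close>

theorem theorem1p2p3:
  fixes Q :: "'a::{field,finite} poly" and q n k :: nat
  assumes "q = CARD('a)"
    and "Q \<in> monics" and "irreducible Q"
    and "int n \<le> int (degree Q) - 1" and "int (degree Q) - 1 \<le> int k"
  shows
    "1 / real q ^ (k + n) *
       (\<Sum>K \<in> monics_deg k. \<Sum>N \<in> (monics_deg n :: 'a poly set).
          real (divisor_count (K * Q + N)) * real (divisor_count N))
     = (1 / real q ^ n * (\<Sum>N \<in> (monics_deg n :: 'a poly set). real (divisor_count N))) *
       (1 / real q ^ (k + n) *
          (\<Sum>K \<in> monics_deg k. \<Sum>N \<in> monics_deg n. real (divisor_count (K * Q + N))))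
     \<and>
     1 / real q ^ (k + n) *
       (\<Sum>K \<in> monics_deg k. \<Sum>N \<in> (monics_deg n :: 'a poly set).
          real (divisor_count (K * Q + N)) * real (divisor_count N))
     = (real (degree Q) + real k + 1) * (real n + 1)
       - real q powi (- int (degree Q)) * (real k - real (degree Q) + 1) * (real n + 1)"
proof -
  let ?M = "monics_deg n :: 'a poly set"
  let ?V = "(real (degree Q) + real k + 1) * real q ^ k -
    (real k - real (degree Q) + 1) * (real q ^ k / real q ^ degree Q)"
  have q: "real q \<noteq> 0" using assms(1) by simp
  have lead: "lead_coeff Q = 1" using assms(2) by (simp add: monics_def)
  have inner: "(\<Sum>K\<in>monics_deg k. real (divisor_count (K * Q + N))) = ?V" if "N \<in> ?M" for N
    unfolding assms(1)
    by (rule sum_divisor_count_residue_class)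
      (use that lead assms(3-5) in \<open>auto simp: monics_deg_iff\<close>)
  have sumN: "(\<Sum>N\<in>?M. real (divisor_count N)) = (real n + 1) * real q ^ n"
    using arg_cong[OF sum_divisor_count_monics_deg[where 'a = 'a and n = n], of real] assms(1)
    by (simp add: algebra_simps)
  have corr: "(\<Sum>K\<in>monics_deg k. \<Sum>N\<in>?M. real (divisor_count (K * Q + N)) * real (divisor_count N))
      = ?V * ((real n + 1) * real q ^ n)"
    by (subst sum.swap) (simp add: inner flip: sum_distrib_right sum_distrib_left sumN)
  have total: "(\<Sum>K\<in>monics_deg k. \<Sum>N\<in>?M. real (divisor_count (K * Q + N))) = real q ^ n * ?V"
    by (subst sum.swap) (simp add: inner card_monics_deg assms(1))
  show ?thesis
    unfolding corr total sumN
    using q by (simp add: power_add power_int_minus field_simps)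
qed

end
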